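(* Let $r_k,s_k,t_k$ be elements of a commutative ring, let $C^{\gamma,\sigma,\tau}=(c_{i,j})$ be the associated Catalan-Stieltjes matrix, and fix $n\ge1$. Equip the digraph $D^{C_n}$ with weights as follows: for each $m=0,1,\dots,n-1$ independently choose a Type $w_m\in\{1,2,3,4,5\}$ (Type 5 allowed only if there are ring elements $b_k,c_k$ with $r_k=1$, $s_k=b_k+c_k$, $t_{k+1}=b_{k+1}c_k$ for all $k\ge0$) and give the arcs of the block $D^{L_m}$ the weights of that Type; give all connecting arcs weight $1$. Then for all $0\le i,j\le n$, $$c_{i,j}=GF\big(P_{n-i}^{(0)},P_{n-j}^{(n)}\big).$$
   Context: The Catalan-Stieltjes matrix $C^{\gamma,\sigma,\tau}=(c_{i,j})_{i,j\ge0}$ is lower triangular ($c_{i,j}=0$ for $j>i$), with $c_{0,0}=1$, $c_{i,0}=s_0c_{i-1,0}+t_1c_{i-1,1}$ and $c_{i,j}=r_{j-1}c_{i-1,j-1}+s_jc_{i-1,j}+t_{j+1}c_{i-1,j+1}$ for $i,j\ge1$. Conventions: $r_{-1}=t_0=0$. For $m\ge0$ the block $D^{L_m}$ has vertices $P_i^{(m)},Q_i^{(m)},P_i^{(m+1)}$ ($0\le i\le m+1$) and arcs: $P_k^{(m)}\to Q_k^{(m)}$, $Q_k^{(m)}\to P_k^{(m+1)}$ ($0\le k\le m+1$); $P_k^{(m)}\to Q_{k+1}^{(m)}$, $Q_k^{(m)}\to P_{k+1}^{(m+1)}$, $P_k^{(m)}\to P_{k+1}^{(m+1)}$ ($0\le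 k\le m$). The digraph $D^{C_n}$ is the union of the blocks $D^{L_0},\dots,D^{L_{n-1}}$ (vertices with the same name identified) together with the connecting arcs $P_i^{(m)}\to P_i^{(m+1)}$ for $0\le m\le n-1$ and $m+2\le i\le n$ (with the needed vertices added). $GF(u,v)$ denotes the sum over directed paths from $u$ to $v$ of the product of arc weights, $GF(u,u)=1$. Weights on block $D^{L_m}$ (for $0\le k\le m$ unless stated; unlisted arcs of the block get weight $1$): Type 1: $P_k^{(m)}\to Q_k^{(m)}$: $r_{m-k}$; $P_k^{(m)}\to Q_{k+1}^{(m)}$: $t_{m-k}$; $P_k^{(m)}\to P_{k+1}^{(m+1)}$: $s_{m-k}-r_{m-k}-t_{m-k}$. Type 2: $Q_k^{(m)}\to P_k^{(m+1)}$: $r_{m-k}$; $Q_k^{(m)}\to P_{k+1}^{(m+1)}$: $t_{m-k+1}$; $P_k^{(m)}\to P_{k+1}^{(m+1)}$: $s_{m-k}-r_{m-k-1}-t_{m-k+1}$; $P_m^{(m)}\to Q_{m+1}^{(m)}$: $0$. Type 3: $Q_k^{(m)}\to P_k^{(m+1)}$: $r_{m-k}$; $P_k^{(m)}\to Q_{k+1}^{(m)}$: $t_{m-k}$; $P_k^{(m)}\to P_{k+1}^{(m+1)}$: $s_{m-k}-r_{m-k-1}t_{m-k}-1$. Type 4: $P_k^{(m)}\to Q_k^{(m)}$: $r_{m-k}$; $Q_k^{(m)}\to P_{k+1}^{(m+1)}$: $t_{m-k+1}$; $P_k^{(m)}\to P_{k+1}^{(m+1)}$: $s_{m-k}-r_{m-k}t_{m-k+1}-1$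 for $0\le k\le m-1$; $P_m^{(m)}\to P_{m+1}^{(m+1)}$: $s_0-r_0t_1$; $P_m^{(m)}\to Q_{m+1}^{(m)}$: $0$. Type 5: $P_k^{(m)}\to Q_{k+1}^{(m)}$: $b_{m-k}$; $Q_k^{(m)}\to P_{k+1}^{(m+1)}$: $c_{m-k}$; $P_k^{(m)}\to P_{k+1}^{(m+1)}$: $0$. *)

theory Defs
  imports "Graph_Theory.Arc_Walk"
begin

(* Coefficients live in 'a::{comm_ring,comm_monoid_mult}: commutative rings with 1, the zero ring
   included (comm_ring_1 would add 0 \<noteq> 1). *)

text \<open>The Catalan--Stieltjes matrix. Vanishing above the diagonal need not be imposed:
  it follows from the recurrence, see \<open>CS_lower_triangular\<close>.\<close>

fun CS :: "(nat \<Rightarrow> 'a) \<Rightarrow> (nat \<Rightarrow> 'a) \<Rightarrow> (nat \<Rightarrow> 'a) \<Rightarrow> nat \<Rightarrow> nat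
    \<Rightarrow> 'a::{comm_ring,comm_monoid_mult}" where
  "CS r s t 0 0 = 1"
| "CS r s t 0 (Suc j) = 0"
| "CS r s t (Suc i) 0 = s 0 * CS r s t i 0 + t 1 * CS r s t i 1"
| "CS r s t (Suc i) (Suc j) =
     r j * CS r s t i j + s (j + 1) * CS r s t i (j + 1) + t (j + 2) * CS r s t i (j + 2)"

lemma CS_lower_triangular: "i < j \<Longrightarrow> CS r s t i j = 0"
  by (induction r s t i j rule: CS.induct) auto

text \<open>\<open>Pv m i\<close> and \<open>Qv m i\<close> are the vertices $P_i^{(m)}$ and $Q_i^{(m)}$.\<close>

datatype vertex = Pv nat nat | Qv nat nat

text \<open>Arcs are named by their kind and the indices of their tail; the suffix \<open>s\<close> marks the arcs
  that raise the lower index. \<open>Conn m i\<close> is the connecting arc $P_i^{(m)} \to P_i^{(m+1)}$.\<close>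

datatype cs_arc =
    PQ nat nat | QP nat nat | PQs nat nat | QPs nat nat | PPs nat nat | Conn nat nat

primrec arc_tail :: "cs_arc \<Rightarrow> vertex" where
  "arc_tail (PQ m k) = Pv m k"
| "arc_tail (QP m k) = Qv m k"
| "arc_tail (PQs m k) = Pv m k"
| "arc_tail (QPs m k) = Qv m k"
| "arc_tail (PPs m k) = Pv m k"
| "arc_tail (Conn m i) = Pv m i"

primrec arc_head :: "cs_arc \<Rightarrow> vertex" where
  "arc_head (PQ m k) = Qv m k"
| "arc_head (QP m k) = Pv (m + 1) k"
| "arc_head (PQs m k) = Qv m (k + 1)"
| "arc_head (QPs m k) = Pv (m + 1) (k + 1)"
| "arc_head (PPs m k) = Pv (m + 1) (k + 1)"
| "arc_head (Conn m i) = Pv (m + 1) i"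

definition block_digraph :: "nat \<Rightarrow> (vertex, cs_arc) pre_digraph" where
  "block_digraph m = \<lparr>
     verts = (\<Union>i\<le>m + 1. {Pv m i, Qv m i, Pv (m + 1) i}),
     arcs = (\<Union>k\<le>m + 1. {PQ m k, QP m k}) \<union> (\<Union>k\<le>m. {PQs m k, QPs m k, PPs m k}),
     tail = arc_tail, head = arc_head \<rparr>"

definition connecting_arcs :: "nat \<Rightarrow> cs_arc set" where
  "connecting_arcs n = {Conn m i | m i. m < n \<and> m + 2 \<le> i \<and> i \<le> n}"

definition CS_digraph :: "nat \<Rightarrow> (vertex, cs_arc) pre_digraph" where
  "CS_digraph n = \<lparr>
     verts = (\<Union>m<n. verts (block_digraph m))
       \<union> arc_tail ` connecting_arcs n \<union> arc_head ` connecting_arcs n,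
     arcs = (\<Union>m<n. arcs (block_digraph m)) \<union> connecting_arcs n,
     tail = arc_tail, head = arc_head \<rparr>"

lemma finite_connecting_arcs: "finite (connecting_arcs n)"
proof (rule finite_subset)
  show "connecting_arcs n \<subseteq> (\<lambda>(m, i). Conn m i) ` ({..<n} \<times> {..n})"
    by (auto simp: connecting_arcs_def)
qed simp

(* In particular there are no parallel arcs, so naming the arcs is harmless. *)
lemma digraph_CS_digraph: "digraph (CS_digraph n)"
proof
  fix e assume "e \<in> arcs (CS_digraph n)"
  then show "tail (CS_digraph n) e \<in> verts (CS_digraph n)"
    and "head (CS_digraph n) e \<in> verts (CS_digraph n)"
    by (fastforce simp: CS_digraph_def block_digraph_def)+
  show "tail (CS_digraph n) e \<noteq> head (CS_digraph n) e"
    by (cases e) (auto simp: CS_digraph_def)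
next
  show "finite (verts (CS_digraph n))" "finite (arcs (CS_digraph n))"
    by (auto simp: CS_digraph_def block_digraph_def finite_connecting_arcs)
next
  fix e1 e2
  assume "e1 \<in> arcs (CS_digraph n)" "e2 \<in> arcs (CS_digraph n)"
    and "arc_to_ends (CS_digraph n) e1 = arc_to_ends (CS_digraph n) e2"
  then show "e1 = e2"
    by (cases e1; cases e2) (auto simp: CS_digraph_def arc_to_ends_def)
qed

definition GF :: "('v, 'e) pre_digraph \<Rightarrow> ('e \<Rightarrow> 'a::{comm_ring,comm_monoid_mult})
    \<Rightarrow> 'v \<Rightarrow> 'v \<Rightarrow> 'a" where
  "GF G wt u v = (\<Sum>p | pre_digraph.apath G u p v. prod_list (map wt p))"

lemma (in wf_digraph) GF_refl: "u \<in> verts G \<Longrightarrow> GF G wt u u = 1"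
proof -
  assume "u \<in> verts G"
  then have "{p. apath u p u} = {[]}"
    using apath_nonempty_ends by (auto simp: apath_Nil_iff)
  then show ?thesis
    by (simp add: GF_def)
qed

text \<open>\<open>prev r k\<close> is $r_{k-1}$, with the convention $r_{-1} = 0$.\<close>

definition prev :: "(nat \<Rightarrow> 'a) \<Rightarrow> nat \<Rightarrow> 'a::{comm_ring,comm_monoid_mult}" where
  "prev r k = (if k = 0 then 0 else r (k - 1))"

text \<open>The values on \<open>Conn\<close> are placeholders: connecting arcs lie in no block. On block arcs
  the case \<open>k = m + 1\<close> only occurs for \<open>PQ\<close> and \<open>QP\<close>, where the weight is 1 in every type.\<close>

primrec weight1 :: "(nat \<Rightarrow> 'a) \<Rightarrow> (nat \<Rightarrow> 'a) \<Rightarrow> (nat \<Rightarrow> 'a) \<Rightarrow> cs_arc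
    \<Rightarrow> 'a::{comm_ring,comm_monoid_mult}" where
  "weight1 r s t (PQ m k) = (if k \<le> m then r (m - k) else 1)"
| "weight1 r s t (QP m k) = 1"
| "weight1 r s t (PQs m k) = t (m - k)"
| "weight1 r s t (QPs m k) = 1"
| "weight1 r s t (PPs m k) = s (m - k) - r (m - k) - t (m - k)"
| "weight1 r s t (Conn m i) = 1"

primrec weight2 :: "(nat \<Rightarrow> 'a) \<Rightarrow> (nat \<Rightarrow> 'a) \<Rightarrow> (nat \<Rightarrow> 'a) \<Rightarrow> cs_arc
    \<Rightarrow> 'a::{comm_ring,comm_monoid_mult}" where
  "weight2 r s t (PQ m k) = 1"
| "weight2 r s t (QP m k) = (if k \<le> m then r (m - k) else 1)"
| "weight2 r s t (PQs m k) = (if k = m then 0 else 1)"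
| "weight2 r s t (QPs m k) = t (m - k + 1)"
| "weight2 r s t (PPs m k) = s (m - k) - prev r (m - k) - t (m - k + 1)"
| "weight2 r s t (Conn m i) = 1"

primrec weight3 :: "(nat \<Rightarrow> 'a) \<Rightarrow> (nat \<Rightarrow> 'a) \<Rightarrow> (nat \<Rightarrow> 'a) \<Rightarrow> cs_arc
    \<Rightarrow> 'a::{comm_ring,comm_monoid_mult}" where
  "weight3 r s t (PQ m k) = 1"
| "weight3 r s t (QP m k) = (if k \<le> m then r (m - k) else 1)"
| "weight3 r s t (PQs m k) = t (m - k)"
| "weight3 r s t (QPs m k) = 1"
| "weight3 r s t (PPs m k) = s (m - k) - prev r (m - k) * t (m - k) - 1"
| "weight3 r s t (Conn m i) = 1"

primrec weight4 :: "(nat \<Rightarrow> 'a) \<Rightarrow> (nat \<Rightarrow> 'a) \<Rightarrow> (nat \<Rightarrow> 'a) \<Rightarrow> cs_arc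
    \<Rightarrow> 'a::{comm_ring,comm_monoid_mult}" where
  "weight4 r s t (PQ m k) = (if k \<le> m then r (m - k) else 1)"
| "weight4 r s t (QP m k) = 1"
| "weight4 r s t (PQs m k) = (if k = m then 0 else 1)"
| "weight4 r s t (QPs m k) = t (m - k + 1)"
| "weight4 r s t (PPs m k) =
     (if k = m then s 0 - r 0 * t 1 else s (m - k) - r (m - k) * t (m - k + 1) - 1)"
| "weight4 r s t (Conn m i) = 1"

primrec weight5 :: "(nat \<Rightarrow> 'a) \<Rightarrow> (nat \<Rightarrow> 'a) \<Rightarrow> cs_arc
    \<Rightarrow> 'a::{comm_ring,comm_monoid_mult}" where
  "weight5 b c (PQ m k) = 1"
| "weight5 b c (QP m k) = 1"
| "weight5 b c (PQs m k) = b (m - k)"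
| "weight5 b c (QPs m k) = c (m - k)"
| "weight5 b c (PPs m k) = 0"
| "weight5 b c (Conn m i) = 1"

datatype block_type = Type1 | Type2 | Type3 | Type4 | Type5

primrec block_weight :: "(nat \<Rightarrow> 'a) \<Rightarrow> (nat \<Rightarrow> 'a) \<Rightarrow> (nat \<Rightarrow> 'a) \<Rightarrow> (nat \<Rightarrow> 'a) \<Rightarrow> (nat \<Rightarrow> 'a)
    \<Rightarrow> block_type \<Rightarrow> cs_arc \<Rightarrow> 'a::{comm_ring,comm_monoid_mult}" where
  "block_weight r s t b c Type1 = weight1 r s t"
| "block_weight r s t b c Type2 = weight2 r s t"
| "block_weight r s t b c Type3 = weight3 r s t"
| "block_weight r s t b c Type4 = weight4 r s t"
| "block_weight r s t b c Type5 = weight5 b c"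

primrec level :: "cs_arc \<Rightarrow> nat" where
  "level (PQ m k) = m"
| "level (QP m k) = m"
| "level (PQs m k) = m"
| "level (QPs m k) = m"
| "level (PPs m k) = m"
| "level (Conn m i) = m"

lemma level_block: "e \<in> arcs (block_digraph m) \<Longrightarrow> level e = m"
  by (auto simp: block_digraph_def)

text \<open>\<open>w m\<close> is the type chosen for the block with index \<open>m\<close>, to which by \<open>level_block\<close> exactly
  the non-connecting arcs of level \<open>m\<close> belong.\<close>

definition CS_weight :: "(nat \<Rightarrow> 'a) \<Rightarrow> (nat \<Rightarrow> 'a) \<Rightarrow> (nat \<Rightarrow> 'a) \<Rightarrow> (nat \<Rightarrow> 'a) \<Rightarrow> (nat \<Rightarrow> 'a)
    \<Rightarrow> (nat \<Rightarrow> block_type) \<Rightarrow> cs_arc \<Rightarrow> 'a::{comm_ring,comm_monoid_mult}" where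
  "CS_weight r s t b c w e =
     (case e of Conn m i \<Rightarrow> 1 | _ \<Rightarrow> block_weight r s t b c (w (level e)) e)"

end

theory Submission
  imports Defs
begin

text \<open>
  The type of a block is irrelevant: in every case the paths through block \<open>m\<close> that start in
  $P_k^{(m)}$ with \<open>k \<le> m\<close> have total weight $r_{m-k}$, $s_{m-k}$, $t_{m-k}$ according to whether
  they end in $P_k^{(m+1)}$, $P_{k+1}^{(m+1)}$ or $P_{k+2}^{(m+1)}$. Reading $P_k^{(m)}$ as column
  \<open>m - k\<close>, these are the coefficients of the Catalan--Stieltjes recurrence. A path from
  $P_a^{(0)}$ keeps lower index \<open>a\<close> up to level \<open>a\<close>, where it sits in column 0, so the remaining
  levels count the rows of the matrix.
\<close>

text \<open>Consequence used below: a vertex strictly higher than the end of a walk cannot lie on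
  it.\<close>

lemma (in wf_digraph) height_awalk_verts_le:
  fixes h :: "'a \<Rightarrow> nat"
  assumes "\<And>e. e \<in> arcs G \<Longrightarrow> h (tail G e) < h (head G e)"
    and "awalk u p v" and "x \<in> set (awalk_verts u p)"
  shows "h x \<le> h v"
  using assms(2,3)
proof (induction p arbitrary: u x)
  case Nil
  then show ?case by (simp add: awalk_Nil_iff)
next
  case (Cons e p)
  then have e: "e \<in> arcs G" "u = tail G e" and p: "awalk (head G e) p v"
    by (auto simp: awalk_Cons_iff)
  have "h (head G e) \<le> h v"
    using Cons.IH[OF p, of "head G e"] p by (cases p) (auto simp: awalk_Cons_iff)
  then show ?case
    using Cons.IH[OF p] Cons.prems(2) e assms(1)[OF e(1)] by auto
qed

text \<open>\<open>apath\<close> demands distinct vertices, which an appended arc can destroy in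
  general. Here the head of \<open>e\<close> is higher than its tail, hence higher than every vertex
  visited by \<open>p\<close>.\<close>

lemma (in wf_digraph) apath_snoc_iff_if_height:
  fixes h :: "'a \<Rightarrow> nat"
  assumes h: "\<And>e. e \<in> arcs G \<Longrightarrow> h (tail G e) < h (head G e)"
  shows "apath u (p @ [e]) v \<longleftrightarrow> apath u p (tail G e) \<and> e \<in> in_arcs G v"
proof
  assume *: "apath u p (tail G e) \<and> e \<in> in_arcs G v"
  then have e: "e \<in> arcs G" "head G e = v" and p: "awalk u p (tail G e)"
    and d: "distinct (awalk_verts u p)"
    by (auto simp: apath_def)
  have "v \<notin> set (awalk_verts u p)"
    using height_awalk_verts_le[OF h p] h[OF e(1)] e(2) by fastforce
  moreover have w: "awalk u (p @ [e]) v"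
    using p e by (auto simp: awalk_Cons_iff awalk_Nil_iff intro!: exI)
  ultimately show "apath u (p @ [e]) v"
    using d e by (simp add: apath_def awalk_verts_append[OF w])
next
  assume *: "apath u (p @ [e]) v"
  then have w: "awalk u (p @ [e]) v" and d: "distinct (awalk_verts u (p @ [e]))"
    by (auto simp: apath_def)
  then have "awalk u p (tail G e)" "e \<in> in_arcs G v"
    by (auto simp: awalk_Cons_iff awalk_Nil_iff)
  then show "apath u p (tail G e) \<and> e \<in> in_arcs G v"
    using d by (simp add: apath_def awalk_verts_append[OF w])
qed

text \<open>Paths correspond bijectively to pairs of a last arc and the path before it;
  \<open>u \<noteq> v\<close> excludes the empty path. This replaces sums over paths by a local
  recursion.\<close>

lemma (in fin_digraph) GF_in_arcs:
  fixes h :: "'a \<Rightarrow> nat"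
  assumes h: "\<And>e. e \<in> arcs G \<Longrightarrow> h (tail G e) < h (head G e)"
    and "u \<noteq> v"
  shows "GF G wt u v = (\<Sum>e\<in>in_arcs G v. GF G wt u (tail G e) * wt e)"
proof -
  let ?S = "SIGMA e:in_arcs G v. {p. apath u p (tail G e)}"
  have eq: "{p. apath u p v} = (\<lambda>(e, p). p @ [e]) ` ?S" (is "?L = ?R")
  proof
    show "?L \<subseteq> ?R"
    proof
      fix p assume "p \<in> ?L"
      moreover from this have "p \<noteq> []"
        using \<open>u \<noteq> v\<close> by (auto simp: apath_Nil_iff)
      then obtain q e where "p = q @ [e]"
        by (metis rev_exhaust)
      ultimately show "p \<in> ?R"
        using apath_snoc_iff_if_height[OF h] by force
    qed
    show "?R \<subseteq> ?L"
      using apath_snoc_iff_if_height[OF h] by auto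
  qed
  have "inj_on (\<lambda>(e, p). p @ [e]) ?S"
    by (auto simp: inj_on_def)
  then have "GF G wt u v = (\<Sum>(e, p)\<in>?S. prod_list (map wt p) * wt e)"
    unfolding GF_def eq by (subst sum.reindex) (auto simp: case_prod_unfold intro!: sum.cong)
  also have "\<dots> = (\<Sum>e\<in>in_arcs G v. \<Sum>p | apath u p (tail G e). prod_list (map wt p) * wt e)"
    by (subst sum.Sigma) (auto simp: apaths_finite in_arcs_def)
  finally show ?thesis
    by (simp add: GF_def sum_distrib_right)
qed

text \<open>Doubling leaves room for the \<open>Qv\<close> vertices between consecutive levels of
  \<open>Pv\<close> vertices.\<close>

primrec height :: "vertex \<Rightarrow> nat" where
  "height (Pv m k) = 2 * m"
| "height (Qv m k) = 2 * m + 1"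

lemma height_CS_digraph:
  "e \<in> arcs (CS_digraph n) \<Longrightarrow> height (tail (CS_digraph n) e) < height (head (CS_digraph n) e)"
  by (cases e) (auto simp: CS_digraph_def)

lemma tail_CS_digraph [simp]: "tail (CS_digraph n) = arc_tail"
  by (simp add: CS_digraph_def)

lemma GF_CS_digraph_in_arcs:
  "u \<noteq> v \<Longrightarrow> GF (CS_digraph n) wt u v =
     (\<Sum>e\<in>in_arcs (CS_digraph n) v. GF (CS_digraph n) wt u (arc_tail e) * wt e)"
proof -
  interpret digraph "CS_digraph n" by (rule digraph_CS_digraph)
  show "u \<noteq> v \<Longrightarrow> ?thesis"
    using GF_in_arcs[OF height_CS_digraph] by simp
qed

text \<open>Block arcs enter level \<open>Suc m\<close> at lower indices up to \<open>m + 1\<close>,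
  connecting arcs from \<open>m + 2\<close> on, so the two kinds never share a head.\<close>

lemma in_arcs_CS_digraph:
  "in_arcs (CS_digraph n) (Pv 0 y) = {}"
  "m < n \<Longrightarrow> m + 2 \<le> y \<Longrightarrow> y \<le> n \<Longrightarrow> in_arcs (CS_digraph n) (Pv (Suc m) y) = {Conn m y}"
  "m < n \<Longrightarrow> in_arcs (CS_digraph n) (Pv (Suc m) 0) = {QP m 0}"
  "m < n \<Longrightarrow> y \<le> m \<Longrightarrow>
     in_arcs (CS_digraph n) (Pv (Suc m) (Suc y)) = {QP m (Suc y), QPs m y, PPs m y}"
  "m < n \<Longrightarrow> in_arcs (CS_digraph n) (Qv m 0) = {PQ m 0}"
  "m < n \<Longrightarrow> y \<le> m \<Longrightarrow> in_arcs (CS_digraph n) (Qv m (Suc y)) = {PQ m (Suc y), PQs m y}"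
proof -
  have *: "e \<in> in_arcs (CS_digraph n) v \<longleftrightarrow> arc_head e = v \<and>
      ((case e of
         PQ m k \<Rightarrow> m < n \<and> k \<le> m + 1
       | QP m k \<Rightarrow> m < n \<and> k \<le> m + 1
       | PQs m k \<Rightarrow> m < n \<and> k \<le> m
       | QPs m k \<Rightarrow> m < n \<and> k \<le> m
       | PPs m k \<Rightarrow> m < n \<and> k \<le> m
       | Conn m i \<Rightarrow> m < n \<and> m + 2 \<le> i \<and> i \<le> n))" for e v
    by (cases e) (auto simp: CS_digraph_def block_digraph_def connecting_arcs_def)
  show "in_arcs (CS_digraph n) (Pv 0 y) = {}"
    "m < n \<Longrightarrow> m + 2 \<le> y \<Longrightarrow> y \<le> n \<Longrightarrow> in_arcs (CS_digraph n) (Pv (Suc m) y) = {Conn m y}"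
    "m < n \<Longrightarrow> in_arcs (CS_digraph n) (Pv (Suc m) 0) = {QP m 0}"
    "m < n \<Longrightarrow> y \<le> m \<Longrightarrow>
       in_arcs (CS_digraph n) (Pv (Suc m) (Suc y)) = {QP m (Suc y), QPs m y, PPs m y}"
    "m < n \<Longrightarrow> in_arcs (CS_digraph n) (Qv m 0) = {PQ m 0}"
    "m < n \<Longrightarrow> y \<le> m \<Longrightarrow> in_arcs (CS_digraph n) (Qv m (Suc y)) = {PQ m (Suc y), PQs m y}"
    unfolding set_eq_iff * by (auto split: cs_arc.splits)
qed

lemma Pv_0_in_verts: "n \<ge> 1 \<Longrightarrow> a \<le> n \<Longrightarrow> Pv 0 a \<in> verts (CS_digraph n)"
\<comment> \<open>Block 0 supplies only the lower indices 0 and 1 at level 0; larger ones enter as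
  tails of connecting arcs.\<close>
proof (cases "a \<le> 1")
  case True
  then show "n \<ge> 1 \<Longrightarrow> ?thesis"
    by (auto simp: CS_digraph_def block_digraph_def intro!: bexI[of _ 0])
next
  case False
  assume "n \<ge> 1" "a \<le> n"
  then have "Conn 0 a \<in> connecting_arcs n"
    using False by (auto simp: connecting_arcs_def)
  then have "arc_tail (Conn 0 a) \<in> arc_tail ` connecting_arcs n"
    by (rule imageI)
  then show ?thesis
    by (simp add: CS_digraph_def)
qed

lemma CS_weight_block_transfer:
  fixes r s t b c :: "nat \<Rightarrow> 'a::{comm_ring,comm_monoid_mult}"
    and w :: "nat \<Rightarrow> block_type"
  defines "wt \<equiv> CS_weight r s t b c w"
  assumes t0: "t 0 = 0"
    and type5: "w m = Type5 \<Longrightarrow> (\<forall>k. r k = 1 \<and> s k = b k + c k \<and> t (k + 1) = b (k + 1) * c k)"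
  shows "x \<le> m \<Longrightarrow> wt (PQ m x) * wt (QP m x) = r (m - x)"
    and "x \<le> m \<Longrightarrow> wt (PQ m x) * wt (QPs m x) + wt (PQs m x) * wt (QP m (Suc x)) + wt (PPs m x)
      = s (m - x)"
    and "x < m \<Longrightarrow> wt (PQs m x) * wt (QPs m (Suc x)) = t (m - x)"
proof -
  \<comment> \<open>Aligns \<open>t (m - x)\<close> with the shifted index \<open>m - k + 1\<close>
    of Types 2 and 4 and with \<open>t (k + 1)\<close> of Type 5.\<close>
  have *: "x < m \<Longrightarrow> m - x = Suc (m - Suc x)"
    by simp
  show "x \<le> m \<Longrightarrow> wt (PQ m x) * wt (QP m x) = r (m - x)"
    using type5 by (cases "w m") (auto simp: wt_def CS_weight_def)
  show "x < m \<Longrightarrow> wt (PQs m x) * wt (QPs m (Suc x)) = t (m - x)"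
    using type5 by (cases "w m") (auto simp: wt_def CS_weight_def *)
  \<comment> \<open>The boundary \<open>x = m\<close> is special: \<open>QP m (Suc m)\<close> has
    weight 1, not a value of \<open>r\<close>. Its product with \<open>PQs m m\<close> is 0 in Types
    1 to 4, by \<open>t 0 = 0\<close> or by the prescribed weight 0, and \<open>b 0\<close> in Type
    5.\<close>
  show "x \<le> m \<Longrightarrow> wt (PQ m x) * wt (QPs m x) + wt (PQs m x) * wt (QP m (Suc x)) + wt (PPs m x)
      = s (m - x)"
    using type5 t0
    by (cases "w m"; cases "x = m") (auto simp: wt_def CS_weight_def prev_def algebra_simps)
qed

text \<open>The straight route from \<open>Pv m (Suc m)\<close> through \<open>Qv m (Suc m)\<close>
  thus has weight 1, like a connecting arc, so the starting index \<open>a\<close> is carried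
  unchanged up to level \<open>a\<close>.\<close>

lemma CS_weight_boundary:
  "CS_weight r s t b c w (PQ m (Suc m)) = 1"
  "CS_weight r s t b c w (QP m (Suc m)) = 1"
  "CS_weight r s t b c w (Conn m i) = 1"
  by (cases "w m"; simp add: CS_weight_def)+

text \<open>Admitting every level \<open>m\<close> as target makes induction over levels possible.
  The second branch covers paths that have not yet reached level \<open>a\<close> and targets
  \<open>y > m\<close>, out of reach once \<open>a \<le> m\<close>.\<close>

lemma GF_CS_digraph:
  fixes r s t b c :: "nat \<Rightarrow> 'a::{comm_ring,comm_monoid_mult}"
  assumes "n \<ge> 1"
    and t0: "t 0 = 0"
    and type5: "\<And>m. m < n \<Longrightarrow> w m = Type5 \<Longrightarrow>
      (\<forall>k. r k = 1 \<and> s k = b k + c k \<and> t (k + 1) = b (k + 1) * c k)"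
    and "a \<le> n" "m \<le> n" "y \<le> n"
  shows "GF (CS_digraph n) (CS_weight r s t b c w) (Pv 0 a) (Pv m y) =
    (if a \<le> m \<and> y \<le> m then CS r s t (m - a) (m - y) else if y = a then 1 else 0)"
  using \<open>m \<le> n\<close> \<open>y \<le> n\<close>
proof (induction m arbitrary: y)
  case 0
  interpret digraph "CS_digraph n" by (rule digraph_CS_digraph)
  show ?case
    using GF_refl[OF Pv_0_in_verts[OF \<open>n \<ge> 1\<close> \<open>a \<le> n\<close>]]
    by (cases "y = a") (auto simp: GF_CS_digraph_in_arcs in_arcs_CS_digraph)
next
  case (Suc m)
  let ?wt = "CS_weight r s t b c w"
  define F where "F \<equiv> GF (CS_digraph n) ?wt (Pv 0 a)"
  have "m < n" using Suc.prems by simp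
  have IH: "F (Pv m y) =
      (if a \<le> m \<and> y \<le> m then CS r s t (m - a) (m - y) else if y = a then 1 else 0)"
    if "y \<le> n" for y
    using Suc.IH[of y] that Suc.prems by (simp add: F_def)
  have step: "F v = (\<Sum>e\<in>in_arcs (CS_digraph n) v. F (arc_tail e) * ?wt e)" if "v \<noteq> Pv 0 a" for v
    unfolding F_def using that by (subst GF_CS_digraph_in_arcs) auto
  have PS: "F (Pv (Suc m) (Suc x)) = F (Qv m (Suc x)) * ?wt (QP m (Suc x))
      + F (Qv m x) * ?wt (QPs m x) + F (Pv m x) * ?wt (PPs m x)" if "x \<le> m" for x
    using \<open>m < n\<close> that by (subst step) (auto simp: in_arcs_CS_digraph add.assoc)
  have Q0: "F (Qv m 0) = F (Pv m 0) * ?wt (PQ m 0)"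
    using \<open>m < n\<close> by (subst step) (auto simp: in_arcs_CS_digraph)
  have QS: "F (Qv m (Suc x)) = F (Pv m (Suc x)) * ?wt (PQ m (Suc x)) + F (Pv m x) * ?wt (PQs m x)"
    if "x \<le> m" for x
    using \<open>m < n\<close> that by (subst step) (auto simp: in_arcs_CS_digraph)
  note T = CS_weight_block_transfer[where r = r and s = s and t = t and b = b and c = c
      and w = w and m = m, OF t0 type5[OF \<open>m < n\<close>]]
  \<comment> \<open>From here the \<open>Qv\<close> values are eliminated, leaving a recursion
    between consecutive levels of \<open>Pv\<close> vertices.\<close>
  have P0: "F (Pv (Suc m) 0) = F (Pv m 0) * r m"
    using \<open>m < n\<close> T(1)[of 0, symmetric] Q0
    by (subst step) (auto simp: in_arcs_CS_digraph mult.assoc)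
  \<comment> \<open>The product stays unevaluated: it is \<open>r (m - 1)\<close> for
    \<open>m \<ge> 1\<close>, but 1 for \<open>m = 0\<close>. The same caution applies in
    \<open>P2\<close> when \<open>Suc (Suc x) = Suc m\<close>.\<close>
  have P1: "F (Pv (Suc m) (Suc 0)) = F (Pv m (Suc 0)) * (?wt (PQ m (Suc 0)) * ?wt (QP m (Suc 0)))
      + F (Pv m 0) * s m"
    using T(2)[of 0, symmetric] PS[of 0] QS[of 0] Q0 by (simp add: algebra_simps)
  have P2: "F (Pv (Suc m) (Suc (Suc x))) =
      F (Pv m (Suc (Suc x))) * (?wt (PQ m (Suc (Suc x))) * ?wt (QP m (Suc (Suc x))))
      + F (Pv m (Suc x)) * s (m - Suc x) + F (Pv m x) * t (m - x)" if "x < m" for x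
    using T(2)[of "Suc x", symmetric] T(3)[of x, symmetric] PS[of "Suc x"] QS[of "Suc x"] QS[of x] that
    by (simp add: algebra_simps)
  have "F (Pv (Suc m) y) =
    (if a \<le> Suc m \<and> y \<le> Suc m then CS r s t (Suc m - a) (Suc m - y) else if y = a then 1 else 0)"
  proof -
    \<comment> \<open>The target lies outside the block, in a positive column, or in column
      0.\<close>
    consider "m + 2 \<le> y" | "y \<le> m" | "y = Suc m" by linarith
    then show ?thesis
    proof cases
      case 1
      then have "F (Pv (Suc m) y) = F (Pv m y)"
        using \<open>m < n\<close> Suc.prems
        by (subst step) (auto simp: in_arcs_CS_digraph CS_weight_boundary)
      then show ?thesis
        using 1 IH[OF Suc.prems(2)] by auto
    next
      case 2
      \<comment> \<open>For \<open>y\<close> equal to 0 or 1 some terms of the matrix recurrence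
        have no matching route; their entries lie above the diagonal and vanish.\<close>
      consider "y = 0" | "y = Suc 0" | x where "y = Suc (Suc x)"
        by (metis nat.exhaust)
      then show ?thesis
      proof cases
        case 1
        then show ?thesis
          using P0 IH[of 0] by (auto simp: CS_lower_triangular Suc_diff_le mult.commute)
      next
        case 2
        then show ?thesis
          using P1 T(1)[of "Suc 0"] IH[of 0] IH[of "Suc 0"] \<open>y \<le> m\<close> \<open>m < n\<close>
          by (cases m) (auto simp: CS_lower_triangular Suc_diff_le mult.commute)
      next
        case (3 x)
        \<comment> \<open>With \<open>j = m - y\<close> these are the columns \<open>j + 2\<close>
          and \<open>j + 1\<close> of the recurrence.\<close>
        moreover from 3 \<open>y \<le> m\<close> have "m - x = Suc (Suc (m - y))" "m - Suc x = Suc (m - y)"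
          by simp_all
        ultimately show ?thesis
          using P2[of x] T(1)[of y] IH[of x] IH[of "Suc x"] IH[of y] \<open>y \<le> m\<close> \<open>m < n\<close>
          by (auto simp: Suc_diff_le mult.commute)
      qed
    next
      case 3
      \<comment> \<open>The straight route contributes \<open>F (Pv m (Suc m))\<close>, which is 1
        for \<open>a = Suc m\<close>, creating the entry \<open>CS r s t 0 0\<close>, and 0
        otherwise; for \<open>a \<le> m\<close> the recurrence for column 0 remains.\<close>
      consider "m = 0" | x where "m = Suc x"
        by (metis nat.exhaust)
      then show ?thesis
      proof cases
        case 1
        then show ?thesis
          using P1 \<open>m < n\<close> IH[of 0] IH[of "Suc 0"] 3
          by (cases a) (auto simp: CS_weight_boundary(1,2)[where m = 0] mult.commute)
      next
        case (2 x)
        then show ?thesis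
          using P2[of x] \<open>m < n\<close> IH[of x] IH[of m] IH[of y] 3
          by (auto simp: CS_weight_boundary(1,2)[where m = "Suc x"] Suc_diff_le mult.commute)
      qed
    qed
  qed
  then show ?case
    by (simp add: F_def)
qed

theorem theorem2p3:
  fixes r s t b c :: "nat \<Rightarrow> 'a::{comm_ring,comm_monoid_mult}"
    and w :: "nat \<Rightarrow> block_type" and n i j :: nat
  assumes "n \<ge> 1"
    and t0: "t 0 = 0"
    and type5: "\<And>m. m < n \<Longrightarrow> w m = Type5 \<Longrightarrow>
      (\<forall>k. r k = 1 \<and> s k = b k + c k \<and> t (k + 1) = b (k + 1) * c k)"
    and "i \<le> n" and "j \<le> n"
  shows "CS r s t i j =
    GF (CS_digraph n) (CS_weight r s t b c w) (Pv 0 (n - i)) (Pv n (n - j))"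
  using GF_CS_digraph[where a = "n - i" and m = n and y = "n - j", OF assms(1) t0 type5] assms(4,5)
  by simp

end
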